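(* Let $G=(V,q)$ be a finite connected reversible graph with non-negative Ollivier curvature. Let $f:V\to\mathbb R$ satisfy $\Delta f=-\lambda f$ with $\lambda\ne0$. Then \[ \|\nabla f\|_\infty^2\le\frac{2e\lambda}{q_{\min}}\|f\|_\infty^2. \]
   Context: A graph $G=(V,q)$: $V$ finite, $q:V\times V\to[0,\infty)$; Laplacian $\Delta f(x)=\sum_yq(x,y)(f(y)-f(x))$. Reversible: there is $m:V\to(0,\infty)$ with $q(x,y)m(x)=q(y,x)m(y)$. $d$ is the combinatorial graph distance ($x\sim y$ iff $q(x,y)>0$). $q_{\min}=\min\{q(x,y):q(x,y)>0\}$. $\|f\|_\infty=\max_x|f(x)|$. For $x\ne y$, $\nabla_{xy}f=(f(x)-f(y))/d(x,y)$, $\|\nabla f\|_\infty=\sup_{x\ne y}|\nabla_{xy}f|$. Ollivier curvature $\kappa(x,y)=\inf\{\nabla_{xy}\Delta f:\|\nabla f\|_\infty=1,\ \nabla_{yx}f=1\}$; non-negative means $\kappa(x,y)\ge0$ for all $x\ne y$. *)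

theory Defs
  imports Complex_Main
begin

definition adj :: "('a \<Rightarrow> 'a \<Rightarrow> real) \<Rightarrow> 'a \<Rightarrow> 'a \<Rightarrow> bool" where
  "adj q x y \<longleftrightarrow> q x y > 0"

definition nonneg_weights :: "('a \<Rightarrow> 'a \<Rightarrow> real) \<Rightarrow> bool" where
  "nonneg_weights q \<longleftrightarrow> (\<forall>x y. q x y \<ge> 0)"

definition reversible :: "('a \<Rightarrow> 'a \<Rightarrow> real) \<Rightarrow> bool" where
  "reversible q \<longleftrightarrow> (\<exists>m::'a \<Rightarrow> real. (\<forall>x. m x > 0) \<and> (\<forall>x y. q x y * m x = q y x * m y))"

definition connected_graph :: "('a \<Rightarrow> 'a \<Rightarrow> real) \<Rightarrow> bool" where
  "connected_graph q \<longleftrightarrow> (\<forall>x y. \<exists>n. (adj q ^^ n) x y)"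

definition gdist :: "('a \<Rightarrow> 'a \<Rightarrow> real) \<Rightarrow> 'a \<Rightarrow> 'a \<Rightarrow> nat" where
  "gdist q x y = (LEAST n. (adj q ^^ n) x y)"

definition laplacian :: "('a::finite \<Rightarrow> 'a \<Rightarrow> real) \<Rightarrow> ('a \<Rightarrow> real) \<Rightarrow> 'a \<Rightarrow> real" where
  "laplacian q f x = (\<Sum>y\<in>UNIV. q x y * (f y - f x))"

definition grad :: "('a \<Rightarrow> 'a \<Rightarrow> real) \<Rightarrow> ('a \<Rightarrow> real) \<Rightarrow> 'a \<Rightarrow> 'a \<Rightarrow> real" where
  "grad q f x y = (f x - f y) / real (gdist q x y)"

text \<open>Sup over x ~= y of |grad|; taken to be 0 if there are no such pairs.\<close>
definition grad_norm :: "('a::finite \<Rightarrow> 'a \<Rightarrow> real) \<Rightarrow> ('a \<Rightarrow> real) \<Rightarrow> real" where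
  "grad_norm q f = Max (insert 0 {\<bar>grad q f x y\<bar> | x y. x \<noteq> y})"

definition sup_norm :: "('a::finite \<Rightarrow> real) \<Rightarrow> real" where
  "sup_norm f = Max (range (\<lambda>x. \<bar>f x\<bar>))"

definition q_min :: "('a::finite \<Rightarrow> 'a \<Rightarrow> real) \<Rightarrow> real" where
  "q_min q = Min {q x y | x y. q x y > 0}"

definition ollivier_curvature :: "('a::finite \<Rightarrow> 'a \<Rightarrow> real) \<Rightarrow> 'a \<Rightarrow> 'a \<Rightarrow> real" where
  "ollivier_curvature q x y =
     Inf {grad q (laplacian q f) x y | f. grad_norm q f = 1 \<and> grad q f y x = 1}"

definition nonneg_ollivier :: "('a::finite \<Rightarrow> 'a \<Rightarrow> real) \<Rightarrow> bool" where
  "nonneg_ollivier q \<longleftrightarrow> (\<forall>x y. x \<noteq> y \<longrightarrow> ollivier_curvature q x y \<ge> 0)"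

end

theory Submission
  imports Defs
begin

text \<open>If \<open>f u - f v \<le> \<phi> (d u v)\<close> for a concave \<open>\<phi>\<close>, with equality at \<open>x \<noteq> y\<close>, then non-negative
  curvature forces \<open>\<Delta> f x - \<Delta> f y \<le> q\<^sub>m\<^sub>i\<^sub>n \<phi>'' (d x y)\<close>, where \<open>\<phi>''\<close> is the second difference.
  For an eigenfunction, take \<open>\<phi>\<close> to be a multiple of the solution of \<open>\<phi>'' = - s \<phi>\<close> with
  \<open>\<phi> 0 = 0\<close>, a sine, frozen from its first maximum on. If \<open>q\<^sub>m\<^sub>i\<^sub>n s > \<lambda>\<close>, equality is impossible
  before the maximum, and beyond it the trivial bound \<open>f x - f y \<le> 2 \<parallel>f\<parallel>\<close> takes over. The slope of
  \<open>\<phi>\<close> at \<open>0\<close> then gives \<open>\<parallel>\<nabla> f\<parallel>\<^sup>2 \<le> 4 s \<parallel>f\<parallel>\<^sup>2\<close>, and \<open>s = e \<lambda> / (2 q\<^sub>m\<^sub>i\<^sub>n)\<close> is admissible because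
  \<open>e > 2\<close>.\<close>

section \<open>Combinatorial distance on a connected reversible graph\<close>

lemma gdist_relpow:
  assumes "connected_graph q"
  shows "(adj q ^^ gdist q x y) x y"
  using assms unfolding connected_graph_def gdist_def by (metis LeastI_ex)

lemma gdist_le: "(adj q ^^ n) x y \<Longrightarrow> gdist q x y \<le> n"
  unfolding gdist_def by (rule Least_le)

lemma gdist_self [simp]: "gdist q x x = 0"
  using gdist_le[of 0 q x x] by simp

lemma gdist_pos:
  assumes "connected_graph q" "x \<noteq> y"
  shows "gdist q x y > 0"
  using gdist_relpow[OF assms(1), of x y] assms(2) by (cases "gdist q x y") auto

lemma gdist_triangle:
  assumes "connected_graph q"
  shows "gdist q x z \<le> gdist q x y + gdist q y z"
  using gdist_relpow[OF assms, of x y] gdist_relpow[OF assms, of y z]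
  by (intro gdist_le) (auto simp: relpowp_add)

lemma gdist_adj: "adj q x y \<Longrightarrow> gdist q x y \<le> 1"
  by (rule gdist_le) auto

lemma gdist_step:
  assumes "connected_graph q" "x \<noteq> y"
  obtains x' where "adj q x x'" "gdist q x' y + 1 \<le> gdist q x y"
proof -
  obtain n where n: "gdist q x y = Suc n"
    using gdist_pos[OF assms] gr0_implies_Suc by blast
  then have "(adj q ^^ Suc n) x y" using gdist_relpow[OF assms(1), of x y] by metis
  then obtain x' where "adj q x x'" "(adj q ^^ n) x' y" by (metis relpowp_Suc_D2)
  then show thesis using that n gdist_le by fastforce
qed

lemma reversible_adj_sym:
  assumes "reversible q" "adj q x y"
  shows "adj q y x"
proof -
  obtain m where m: "\<And>x. (m x :: real) > 0" "\<And>x y. q x y * m x = q y x * m y"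
    using assms(1) unfolding reversible_def by blast
  have "q y x * m y > 0" using m assms(2) unfolding adj_def by (metis mult_pos_pos)
  then show ?thesis using m(1)[of y] unfolding adj_def by (simp add: zero_less_mult_iff)
qed

lemma gdist_sym:
  assumes "reversible q" "connected_graph q"
  shows "gdist q x y = gdist q y x"
proof -
  have rev: "(adj q ^^ n) x y \<Longrightarrow> (adj q ^^ n) y x" for n x y
  proof (induction n arbitrary: x y)
    case (Suc n)
    then obtain z where "adj q x z" "(adj q ^^ n) z y" by (metis relpowp_Suc_D2)
    then have "adj q z x" "(adj q ^^ n) y z" using reversible_adj_sym[OF assms(1)] Suc.IH by auto
    then show ?case by auto
  qed auto
  show ?thesis
    using rev[OF gdist_relpow[OF assms(2), of x y]] rev[OF gdist_relpow[OF assms(2), of y x]]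
    by (meson antisym gdist_le)
qed

section \<open>Norms and the minimal weight as finite extrema\<close>

lemma finite_grads: "finite (insert 0 {\<bar>grad q f x y\<bar> | x y. x \<noteq> (y :: 'a :: finite)})"
proof -
  have "{\<bar>grad q f x y\<bar> | x y. x \<noteq> y} \<subseteq> (\<lambda>(x, y). \<bar>grad q f x y\<bar>) ` UNIV" by auto
  then show ?thesis using finite_subset by fastforce
qed

lemma abs_grad_le_grad_norm: "x \<noteq> y \<Longrightarrow> \<bar>grad q f x y\<bar> \<le> grad_norm q f"
  unfolding grad_norm_def by (intro Max_ge finite_grads) auto

lemma grad_norm_nonneg: "grad_norm q f \<ge> 0"
  unfolding grad_norm_def by (intro Max_ge finite_grads) auto

lemma grad_norm_le:
  assumes "C \<ge> 0" "\<And>x y. x \<noteq> y \<Longrightarrow> \<bar>grad q f x y\<bar> \<le> C"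
  shows "grad_norm q f \<le> C"
  unfolding grad_norm_def using assms by (subst Max_le_iff[OF finite_grads]) auto

lemma abs_le_sup_norm: "\<bar>f x\<bar> \<le> sup_norm f"
  unfolding sup_norm_def by (intro Max_ge) auto

lemma sup_norm_attained: "\<exists>x. sup_norm f = \<bar>f x\<bar>"
proof -
  have "Max (range (\<lambda>x. \<bar>f x\<bar>)) \<in> range (\<lambda>x. \<bar>f x\<bar>)" by (intro Max_in) auto
  then show ?thesis unfolding sup_norm_def by (auto simp only: image_iff)
qed

lemma finite_positive_weights: "finite {q x y | x y. q x y > (0 :: real)}"
  for q :: "'a :: finite \<Rightarrow> 'a \<Rightarrow> real"
proof -
  have "{q x y | x y. q x y > 0} \<subseteq> (\<lambda>(x, y). q x y) ` UNIV" by auto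
  then show ?thesis using finite_subset by fastforce
qed

lemma q_min_le: "adj q x y \<Longrightarrow> q_min q \<le> q x y"
  unfolding q_min_def adj_def by (intro Min_le finite_positive_weights) auto

lemma q_min_pos:
  assumes "adj q x y"
  shows "q_min q > 0"
  using assms unfolding q_min_def adj_def
  by (subst Min_gr_iff[OF finite_positive_weights]) auto

section \<open>Laplacian comparison under non-negative curvature\<close>

lemma laplacian_divide: "laplacian q (\<lambda>x. g x / a) x = laplacian q g x / a"
  unfolding laplacian_def by (simp add: sum_divide_distrib flip: diff_divide_distrib)

text \<open>A real \<open>Inf\<close> bounds the members of its set from below only if the set is
  bounded below. Gradient norm 1 limits \<open>\<bar>f y - f x\<bar>\<close> to the distance, so the
  Laplacians are bounded independently of \<open>f\<close>.\<close>

lemma bdd_below_curvature_set: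
  assumes "nonneg_weights q" "connected_graph q"
  shows "bdd_below {grad q (laplacian q f) x y | f. grad_norm q f = 1 \<and> grad q f y x = 1}"
proof -
  define K where "K x = (\<Sum>y\<in>UNIV. q x y * real (gdist q x y))" for x
  have K: "\<bar>laplacian q f x\<bar> \<le> K x" if "grad_norm q f = 1" for f x
  proof -
    have "\<bar>f y - f x\<bar> \<le> real (gdist q x y)" for y
    proof (cases "x = y")
      case False
      then have "\<bar>grad q f x y\<bar> \<le> 1" using abs_grad_le_grad_norm that by metis
      then show ?thesis using gdist_pos[OF assms(2) False]
        unfolding grad_def by (simp add: divide_le_eq abs_minus_commute)
    qed auto
    then show ?thesis
      unfolding laplacian_def K_def using assms(1) unfolding nonneg_weights_def
      by (intro order_trans[OF sum_abs] sum_mono) (simp add: abs_mult mult_left_mono)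
  qed
  have "- (K x + K y) / real (gdist q x y) \<le> grad q (laplacian q f) x y"
    if "grad_norm q f = 1" for f
    unfolding grad_def using K[OF that, of x] K[OF that, of y] by (intro divide_right_mono) auto
  then show ?thesis by (intro bdd_belowI) auto
qed

text \<open>Dividing \<open>g\<close> by \<open>a\<close> yields a competitor in the infimum
  defining the curvature. That infimum asks for slope 1 from the second vertex to the first, hence
  the curvature of \<open>(y, x)\<close> is the one to use.\<close>

lemma laplacian_le_of_nonneg_ollivier:
  assumes "nonneg_weights q" "reversible q" "connected_graph q" "nonneg_ollivier q"
    and "x \<noteq> y" "a > 0"
    and lip: "\<And>u v. g u - g v \<le> a * real (gdist q u v)"
    and eq: "g x - g y = a * real (gdist q x y)"
  shows "laplacian q g x \<le> laplacian q g y"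
proof -
  define h where "h u = g u / a" for u
  have d: "real (gdist q x y) > 0" "real (gdist q y x) > 0"
    using gdist_pos[OF assms(3)] assms(5) by auto
  have lip_h: "\<bar>grad q h u v\<bar> \<le> 1" if "u \<noteq> v" for u v
  proof -
    have "\<bar>g u - g v\<bar> \<le> a * real (gdist q u v)"
      using lip[of u v] lip[of v u] gdist_sym[OF assms(2,3), of u v] by auto
    then show ?thesis
      using gdist_pos[OF assms(3) that] \<open>a > 0\<close>
      unfolding grad_def h_def
      by (simp add: diff_divide_distrib[symmetric] divide_le_eq mult.commute)
  qed
  have grad_xy: "grad q h x y = 1"
    using eq d \<open>a > 0\<close> unfolding grad_def h_def by (simp add: diff_divide_distrib[symmetric])
  have "grad_norm q h = 1"
    using grad_norm_le[of 1 q h, OF _ lip_h] abs_grad_le_grad_norm[OF \<open>x \<noteq> y\<close>, of q h] grad_xy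
    by auto
  then have "ollivier_curvature q y x \<le> grad q (laplacian q h) y x"
    unfolding ollivier_curvature_def using grad_xy
    by (intro cInf_lower bdd_below_curvature_set assms) auto
  moreover have "ollivier_curvature q y x \<ge> 0"
    using assms(4,5) unfolding nonneg_ollivier_def by auto
  ultimately have "0 \<le> (laplacian q h y - laplacian q h x) / real (gdist q y x)"
    unfolding grad_def by linarith
  then have "laplacian q h x \<le> laplacian q h y"
    using d by (simp add: zero_le_divide_iff)
  then show ?thesis
    using \<open>a > 0\<close> unfolding h_def laplacian_divide by (simp add: divide_le_cancel)
qed

text \<open>The function \<open>g\<close> below is an \<open>a\<close>-Lipschitz function squeezed between \<open>f\<close> near \<open>x\<close> and
  \<open>f\<close> near \<open>y\<close> (up to constants), so the curvature hypothesis applies to it. This replaces an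
  optimal coupling of the jumps from \<open>x\<close> and \<open>y\<close>.\<close>

lemma laplacian_diff_le_concave_modulus:
  assumes q: "nonneg_weights q" "reversible q" "connected_graph q" "nonneg_ollivier q"
    and "x \<noteq> y" "0 < a" "a \<le> b"
    and touch: "f x - f y = \<phi> (gdist q x y)"
    and modulus: "\<And>u v. f u - f v \<le> \<phi> (gdist q u v)"
    and tangent_a: "\<And>k. \<phi> k \<le> \<phi> (gdist q x y) + a * (real k - real (gdist q x y))"
    and tangent_b: "\<And>k. \<phi> k \<le> \<phi> (gdist q x y) + b * (real k - real (gdist q x y))"
  shows "laplacian q f x - laplacian q f y \<le> - (q_min q * (b - a))"
proof -
  define d where "d = gdist q x y"
  define B where "B = {v. v = y \<or> adj q y v}"
  \<comment> \<open>This is the McShane extension: the largest \<open>a\<close>-Lipschitz function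
    that stays below \<open>f - f y\<close> on \<open>B\<close>.\<close>
  define g where "g w = Min ((\<lambda>v. f v - f y + a * real (gdist q w v)) ` B)" for w
  obtain x' where x': "adj q x x'" "gdist q x' y + 1 \<le> d"
    using gdist_step[OF q(3) \<open>x \<noteq> y\<close>] unfolding d_def by blast
  have B: "finite B" "y \<in> B" unfolding B_def by auto
  have g_le: "g w \<le> f v - f y + a * real (gdist q w v)" if "v \<in> B" for v w
    unfolding g_def using that B by (intro Min_le) auto
  have g_attained: "\<exists>v\<in>B. g w = f v - f y + a * real (gdist q w v)" for w
  proof -
    have "g w \<in> (\<lambda>v. f v - f y + a * real (gdist q w v)) ` B"
      unfolding g_def using B by (intro Min_in) auto
    then show ?thesis by auto
  qed
  have lip: "g u - g w \<le> a * real (gdist q u w)" for u w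
  proof -
    obtain v where v: "v \<in> B" "g w = f v - f y + a * real (gdist q w v)"
      using g_attained by blast
    have "a * real (gdist q u v) \<le> a * real (gdist q u w + gdist q w v)"
      using gdist_triangle[OF q(3), of u v w] \<open>a > 0\<close> by (simp del: of_nat_add)
    then show ?thesis using v g_le[OF v(1), of u] by (simp add: algebra_simps)
  qed
  have g_ge: "f u - f x + a * real d \<le> g u" for u
  proof -
    obtain v where v: "v \<in> B" "g u = f v - f y + a * real (gdist q u v)"
      using g_attained by blast
    show ?thesis
      using v(2) modulus[of u v] tangent_a[of "gdist q u v"] touch
      unfolding d_def by (simp add: algebra_simps)
  qed
  have gx: "g x = a * real d" using g_le[OF B(2), of x] g_ge[of x] unfolding d_def by simp
  have gy: "g y = 0" using g_le[OF B(2), of y] lip[of x y] gx unfolding d_def by simp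
  text \<open>The gain at \<open>x'\<close>: vertices \<open>v\<close> closer to \<open>x'\<close> than \<open>d\<close> profit from the steeper
    slope \<open>b\<close>; for all others, moving \<open>x\<close> and \<open>y\<close> one at a time is already good enough.\<close>
  have g_ge': "f x' - f x + a * real d + (b - a) \<le> g x'"
  proof -
    obtain v where v: "v \<in> B" "g x' = f v - f y + a * real (gdist q x' v)"
      using g_attained by blast
    show ?thesis
    proof (cases "gdist q x' v < d")
      case True
      then have "(b - a) * (real (gdist q x' v) - real d) \<le> (b - a) * (- 1)"
        using \<open>a \<le> b\<close> by (intro mult_left_mono) auto
      then show ?thesis
        using v(2) modulus[of x' v] tangent_b[of "gdist q x' v"] touch
        unfolding d_def by (simp add: algebra_simps)
    next
      case False
      then have far: "a * real d \<le> a * real (gdist q x' v)" using \<open>a > 0\<close> by simp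
      have "gdist q y v \<le> 1" using v(1) gdist_adj unfolding B_def by auto
      then have "gdist q x v \<le> d + 1"
        using gdist_triangle[OF q(3), of x v y] unfolding d_def by linarith
      then have "a * (real (gdist q x v) - real d) \<le> a * 1"
        using \<open>a > 0\<close> by (intro mult_left_mono) auto
      then have xv: "f x - f v \<le> \<phi> d + a"
        using modulus[of x v] tangent_a[of "gdist q x v"] unfolding d_def by linarith
      have "b * (real (gdist q x' y) - real d) \<le> b * (- 1)"
        using x'(2) \<open>a > 0\<close> \<open>a \<le> b\<close> by (intro mult_left_mono) auto
      then have "f x' - f y \<le> \<phi> d - b"
        using modulus[of x' y] tangent_b[of "gdist q x' y"] unfolding d_def by linarith
      then show ?thesis using v(2) xv far touch unfolding d_def by linarith
    qed
  qed
  \<comment> \<open>Only the neighbour \<open>x'\<close>, one step closer to \<open>y\<close>,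
    contributes the extra gain \<open>b - a\<close>; the other vertices use
    \<open>g_ge\<close>.\<close>
  have "laplacian q f x + q x x' * (b - a)
      = (\<Sum>u\<in>UNIV. q x u * (f u - f x) + (if u = x' then q x x' * (b - a) else 0))"
    unfolding laplacian_def by (simp add: sum.distrib)
  also have "\<dots> \<le> laplacian q g x"
    unfolding laplacian_def
  proof (rule sum_mono)
    fix u
    have "q x u * (f u - f x + (if u = x' then b - a else 0)) \<le> q x u * (g u - g x)"
      using g_ge[of u] g_ge' gx q(1) unfolding nonneg_weights_def by (intro mult_left_mono) auto
    then show "q x u * (f u - f x) + (if u = x' then q x x' * (b - a) else 0)
        \<le> q x u * (g u - g x)"
      by (auto simp: algebra_simps split: if_splits)
  qed
  also have "\<dots> \<le> laplacian q g y"
    using gx gy by (intro laplacian_le_of_nonneg_ollivier[OF q \<open>x \<noteq> y\<close> \<open>a > 0\<close> lip]) (simp add: d_def)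
  \<comment> \<open>Only neighbours of \<open>y\<close> enter the sum. They lie in \<open>B\<close>,
    where taking \<open>v\<close> itself in the minimum gives
    \<open>g v \<le> f v - f y\<close>.\<close>
  also have "\<dots> \<le> laplacian q f y"
    unfolding laplacian_def
  proof (rule sum_mono)
    fix v
    show "q y v * (g v - g y) \<le> q y v * (f v - f y)"
    proof (cases "adj q y v")
      case True
      then have "v \<in> B" unfolding B_def by simp
      then show ?thesis
        using True g_le[of v v] gy unfolding adj_def by (intro mult_left_mono) auto
    next
      case False
      then have "q y v = 0" using q(1) unfolding adj_def nonneg_weights_def by (metis less_eq_real_def)
      then show ?thesis by simp
    qed
  qed
  finally have "laplacian q f x + q x x' * (b - a) \<le> laplacian q f y" .
  moreover have "q_min q * (b - a) \<le> q x x' * (b - a)"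
    using q_min_le[OF x'(1)] \<open>a \<le> b\<close> by (intro mult_right_mono) auto
  ultimately show ?thesis by linarith
qed

section \<open>Concave sequences and the sine barrier\<close>

lemma concave_seq_tangent:
  fixes \<phi> :: "nat \<Rightarrow> real"
  assumes concave: "\<And>n. \<phi> (Suc (Suc n)) - \<phi> (Suc n) \<le> \<phi> (Suc n) - \<phi> n"
  shows "\<phi> k \<le> \<phi> d + (\<phi> (Suc d) - \<phi> d) * (real k - real d)"
proof -
  \<comment> \<open>Increments after \<open>d\<close> are at most the one at \<open>d\<close>, and
    earlier ones are at least that; summing them in either direction gives the line.\<close>
  have anti: "\<phi> (Suc n) - \<phi> n \<le> \<phi> (Suc m) - \<phi> m" if "m \<le> n" for m n
    using lift_Suc_antimono_le[of "\<lambda>n. \<phi> (Suc n) - \<phi> n", OF concave that] .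
  show ?thesis
  proof (cases "d \<le> k")
    case True
    then show ?thesis
    proof (induction k rule: dec_induct)
      case (step n)
      then show ?case using anti[of d n] by (simp add: algebra_simps)
    qed simp
  next
    case False
    then have "k \<le> d" by simp
    then show ?thesis
    proof (induction k rule: inc_induct)
      case (step n)
      then show ?case using anti[of n d] by (simp add: algebra_simps)
    qed simp
  qed
qed

text \<open>Choosing \<open>sin \<alpha> = sqrt s / 2\<close> gives
  \<open>2 * cos (2 * \<alpha>) = 2 - s\<close>, so sampling the sine at multiples of
  \<open>2 * \<alpha>\<close> solves the recursion. The bound \<open>s < 4\<close> makes \<alpha>
  acute.\<close>

lemma truncated_sine_barrier:
  assumes "0 < s" "s < (4 :: real)"
  obtains \<phi> :: "nat \<Rightarrow> real" and N :: nat where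
    "\<phi> 0 = 0" "\<phi> 1 = sqrt s" "\<And>n. 0 < n \<Longrightarrow> \<phi> n > 0" "\<And>n. N \<le> n \<Longrightarrow> \<phi> n \<ge> 1"
    "\<And>n. n < N \<Longrightarrow> \<phi> n < \<phi> (Suc n)"
    "\<And>n. Suc n < N \<Longrightarrow> \<phi> (Suc (Suc n)) + \<phi> n = (2 - s) * \<phi> (Suc n)"
    "\<And>n. \<phi> (Suc (Suc n)) - \<phi> (Suc n) \<le> \<phi> (Suc n) - \<phi> n"
proof -
  define \<alpha> where "\<alpha> = arcsin (sqrt s / 2)"
  have "sqrt s < sqrt 4" using assms by (intro real_sqrt_less_mono)
  then have s2: "0 < sqrt s / 2" "sqrt s / 2 < 1" using assms by auto
  have sin\<alpha>: "sin \<alpha> = sqrt s / 2" unfolding \<alpha>_def using s2 by (intro sin_arcsin) linarith+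
  have \<alpha>: "0 < \<alpha>" "\<alpha> < pi / 2"
    using arcsin_less_mono[of 0 "sqrt s / 2"] arcsin_less_mono[of "sqrt s / 2" 1] s2
    unfolding \<alpha>_def by auto
  have cos\<alpha>: "cos \<alpha> > 0" using \<alpha> by (intro cos_gt_zero) auto
  have s: "s = 4 * (sin \<alpha>)\<^sup>2" unfolding sin\<alpha> using assms by (simp add: power_divide)
  \<comment> \<open>The increment of the sine from \<open>n\<close> to \<open>Suc n\<close> is
    \<open>2 * cos (2 * \<alpha> * real n + \<alpha>) * sin \<alpha>\<close>, so \<open>N\<close> is
    the first index where it fails to be positive.\<close>
  define N where "N = (LEAST n. 2 * \<alpha> * real n + \<alpha> \<ge> pi / 2)"
  obtain n :: nat where "real n > pi / (4 * \<alpha>)" using reals_Archimedean2 by blast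
  then have "2 * \<alpha> * real n + \<alpha> \<ge> pi / 2" using \<alpha> by (simp add: field_simps)
  then have N_ge: "2 * \<alpha> * real N + \<alpha> \<ge> pi / 2" unfolding N_def by (rule LeastI)
  have N_less: "2 * \<alpha> * real n + \<alpha> < pi / 2" if "n < N" for n
    using not_less_Least[of n "\<lambda>n. 2 * \<alpha> * real n + \<alpha> \<ge> pi / 2"] that unfolding N_def by auto
  have "N > 0" using N_ge \<alpha> by (cases N) auto
  have N_le: "2 * \<alpha> * real N - \<alpha> < pi / 2"
    using N_less[of "N - 1"] \<open>N > 0\<close> by (simp add: of_nat_diff algebra_simps)
  define \<phi> where "\<phi> n = sin (2 * \<alpha> * real (min n N)) / cos \<alpha>" for n
  \<comment> \<open>By minimality of \<open>N\<close>, the angle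
    \<open>2 * \<alpha> * real N\<close> is within \<alpha> of \<open>pi / 2\<close>.\<close>
  have sinN: "sin (2 * \<alpha> * real N) \<ge> cos \<alpha>"
  proof -
    have "cos \<alpha> \<le> cos \<bar>pi / 2 - 2 * \<alpha> * real N\<bar>"
      using N_ge N_le \<alpha> by (intro cos_monotone_0_pi_le) auto
    then show ?thesis by (simp add: cos_diff)
  qed
  have big: "\<phi> n \<ge> 1" if "N \<le> n" for n
    unfolding \<phi>_def using that sinN cos\<alpha> by (simp add: min_absorb2)
  have pos: "\<phi> n > 0" if "0 < n" for n
  proof (cases "n < N")
    case True
    have "2 * \<alpha> * real n < pi" using N_less[OF True] \<alpha> by linarith
    then show ?thesis
      unfolding \<phi>_def using True that \<alpha> cos\<alpha> by (auto intro!: divide_pos_pos sin_gt_zero)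
  next
    case False
    then show ?thesis using big[of n] by simp
  qed
  have incr: "\<phi> n < \<phi> (Suc n)" if "n < N" for n
  proof -
    have "sin (2 * \<alpha> * real (Suc n)) - sin (2 * \<alpha> * real n)
        = sin ((2 * \<alpha> * real n + \<alpha>) + \<alpha>) - sin ((2 * \<alpha> * real n + \<alpha>) - \<alpha>)"
      by (simp add: algebra_simps)
    also have "\<dots> = 2 * cos (2 * \<alpha> * real n + \<alpha>) * sin \<alpha>"
      unfolding sin_add sin_diff by (simp add: algebra_simps)
    also have "\<dots> > 0"
    proof -
      have "0 \<le> 2 * \<alpha> * real n" using \<alpha> by simp
      moreover have "sin \<alpha> > 0" using s2(1) sin\<alpha> by linarith
      ultimately have "0 < cos (2 * \<alpha> * real n + \<alpha>)"
        using N_less[OF that] \<alpha> by (intro cos_gt_zero_pi) linarith+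
      then show ?thesis using \<open>sin \<alpha> > 0\<close> by simp
    qed
    finally show ?thesis
      unfolding \<phi>_def using that cos\<alpha> by (simp add: min_absorb1 divide_strict_right_mono)
  qed
  have rec: "\<phi> (Suc (Suc n)) + \<phi> n = (2 - s) * \<phi> (Suc n)" if "Suc n < N" for n
  proof -
    define t where "t = 2 * \<alpha> * real (Suc n)"
    have "sin (t + 2 * \<alpha>) + sin (t - 2 * \<alpha>) = 2 * cos (2 * \<alpha>) * sin t"
      unfolding sin_add sin_diff by simp
    also have "2 * cos (2 * \<alpha>) = 2 - s" unfolding s cos_double_sin by simp
    finally have "(sin (t + 2 * \<alpha>) + sin (t - 2 * \<alpha>)) / cos \<alpha> = (2 - s) * (sin t / cos \<alpha>)" by simp
    moreover have "\<phi> (Suc (Suc n)) = sin (t + 2 * \<alpha>) / cos \<alpha>" "\<phi> (Suc n) = sin t / cos \<alpha>"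
      "\<phi> n = sin (t - 2 * \<alpha>) / cos \<alpha>"
      unfolding \<phi>_def t_def using that by (simp_all add: min_absorb1 algebra_simps)
    ultimately show ?thesis by (simp add: add_divide_distrib)
  qed
  have concave: "\<phi> (Suc (Suc n)) - \<phi> (Suc n) \<le> \<phi> (Suc n) - \<phi> n" for n
  proof -
    \<comment> \<open>The recursion settles the sine range; at the kink a positive increment is
      followed by zero; beyond it all increments vanish.\<close>
    consider "Suc n < N" | "Suc n = N" | "N \<le> n" by linarith
    then show ?thesis
    proof cases
      case 1
      have "0 \<le> s * \<phi> (Suc n)" using assms pos[of "Suc n"] by simp
      then show ?thesis using rec[OF 1] by (simp add: algebra_simps)
    next
      case 2
      then have "\<phi> (Suc (Suc n)) = \<phi> (Suc n)" unfolding \<phi>_def by simp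
      then show ?thesis using incr[of n] 2 by simp
    qed (simp add: \<phi>_def)
  qed
  have "\<phi> 1 = sin (2 * \<alpha>) / cos \<alpha>" unfolding \<phi>_def using \<open>N > 0\<close> by (simp add: min_absorb1)
  also have "\<dots> = sqrt s" unfolding sin_double sin\<alpha> using cos\<alpha> by simp
  finally have "\<phi> 1 = sqrt s" .
  then show thesis using that[of \<phi> N] pos big incr rec concave by (auto simp: \<phi>_def)
qed

section \<open>Gradient bounds for eigenfunctions\<close>

lemma eigenvalue_nonneg:
  assumes "nonneg_weights q" "\<And>x. laplacian q f x = - lam * f x" "f x \<noteq> 0"
  shows "lam \<ge> 0"
proof -
  \<comment> \<open>Maximum principle: where \<open>\<bar>f\<bar>\<close> is largest,
    \<open>f\<close> and its Laplacian cannot have the same strict sign.\<close>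
  obtain z where z: "sup_norm f = \<bar>f z\<bar>" using sup_norm_attained by blast
  have max: "\<bar>f u\<bar> \<le> \<bar>f z\<bar>" for u using abs_le_sup_norm[of f u] z by simp
  have "f z \<noteq> 0" using max[of x] assms(3) by auto
  have "f z * laplacian q f z = (\<Sum>u\<in>UNIV. q z u * (f z * f u - (f z)\<^sup>2))"
    unfolding laplacian_def by (simp add: sum_distrib_left algebra_simps power2_eq_square)
  also have "\<dots> \<le> 0"
  proof (intro sum_nonpos mult_nonneg_nonpos)
    fix u
    have "f z * f u \<le> \<bar>f z\<bar> * \<bar>f u\<bar>" by (metis abs_ge_self abs_mult)
    also have "\<dots> \<le> \<bar>f z\<bar> * \<bar>f z\<bar>" using max by (intro mult_left_mono) auto
    finally show "f z * f u - (f z)\<^sup>2 \<le> 0" by (simp add: power2_eq_square)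
  qed (use assms(1) in \<open>auto simp: nonneg_weights_def\<close>)
  finally have "0 \<le> lam * (f z)\<^sup>2" using assms(2) by (simp add: power2_eq_square algebra_simps)
  then show ?thesis using \<open>f z \<noteq> 0\<close> by (simp add: zero_le_mult_iff)
qed

lemma eigenfunction_grad_norm_le:
  assumes q: "nonneg_weights q" "reversible q" "connected_graph q" "nonneg_ollivier q"
    and eigen: "\<And>x. laplacian q f x = - lam * f x"
    and s: "0 < s" "s < 4" "lam < q_min q * s"
  shows "grad_norm q f \<le> 2 * sup_norm f * sqrt s"
proof -
  define M where "M = sup_norm f"
  have fM: "\<bar>f u\<bar> \<le> M" for u unfolding M_def by (rule abs_le_sup_norm)
  then have M0: "M \<ge> 0" using abs_ge_zero order_trans by blast
  obtain \<phi> N where \<phi>0: "\<phi> 0 = (0 :: real)" and \<phi>1: "\<phi> 1 = sqrt s"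
    and pos: "\<And>n. 0 < n \<Longrightarrow> \<phi> n > 0" and big: "\<And>n. (N :: nat) \<le> n \<Longrightarrow> \<phi> n \<ge> 1"
    and incr: "\<And>n. n < N \<Longrightarrow> \<phi> n < \<phi> (Suc n)"
    and rec: "\<And>n. Suc n < N \<Longrightarrow> \<phi> (Suc (Suc n)) + \<phi> n = (2 - s) * \<phi> (Suc n)"
    and concave: "\<And>n. \<phi> (Suc (Suc n)) - \<phi> (Suc n) \<le> \<phi> (Suc n) - \<phi> n"
    using truncated_sine_barrier[OF s(1,2)] by blast
  define r where "r p = (f (fst p) - f (snd p)) / \<phi> (gdist q (fst p) (snd p))" for p
  define P where "P = {p :: 'a \<times> 'a. fst p \<noteq> snd p}"
  have ratio_le: "r p \<le> 2 * M" if "p \<in> P" for p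
  proof (rule ccontr)
    assume "\<not> r p \<le> 2 * M"
    \<comment> \<open>The least factor for which \<open>c * \<phi>\<close> dominates the differences
      of \<open>f\<close>; finiteness of \<open>P\<close> provides a pair attaining
      equality.\<close>
    define c where "c = Max (r ` P)"
    have c_ge: "r p \<le> c" if "p \<in> P" for p
      unfolding c_def using that by (intro Max_ge) auto
    have cM: "c > 2 * M" using c_ge[OF that] \<open>\<not> r p \<le> 2 * M\<close> by linarith
    have c0: "c > 0" using cM M0 by linarith
    have "c \<in> r ` P" unfolding c_def using that by (intro Max_in) auto
    then obtain x y where xy: "x \<noteq> y" "c = (f x - f y) / \<phi> (gdist q x y)"
      unfolding P_def r_def by auto
    obtain n where d: "gdist q x y = Suc n"
      using gdist_pos[OF q(3) xy(1)] gr0_implies_Suc by blast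
    have touch: "f x - f y = c * \<phi> (gdist q x y)"
      using xy(2) pos[of "gdist q x y"] d by (simp add: field_simps)
    have modulus: "f u - f v \<le> c * \<phi> (gdist q u v)" for u v
    proof (cases "u = v")
      case False
      then show ?thesis
        using c_ge[of "(u, v)"] pos[OF gdist_pos[OF q(3) False]]
        unfolding P_def r_def by (simp add: field_simps)
    qed (simp add: \<phi>0)
    have dN: "Suc n < N"
    proof (rule ccontr)
      assume "\<not> Suc n < N"
      then have "c * 1 \<le> c * \<phi> (gdist q x y)"
        using big[of "Suc n"] d c0 by (intro mult_left_mono) auto
      then show False using touch fM[of x] fM[of y] cM by linarith
    qed
    \<comment> \<open>The right and left increments of \<open>c * \<phi>\<close> at the touching
      distance, so \<open>b - a\<close> is minus its second difference there.\<close>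
    define a where "a = c * (\<phi> (Suc (Suc n)) - \<phi> (Suc n))"
    define b where "b = c * (\<phi> (Suc n) - \<phi> n)"
    have "a > 0" unfolding a_def using incr[OF dN] c0 by simp
    have "a \<le> b" unfolding a_def b_def using concave[of n] c0 by simp
    have "laplacian q f x - laplacian q f y \<le> - (q_min q * (b - a))"
    proof (rule laplacian_diff_le_concave_modulus[OF q xy(1) \<open>a > 0\<close> \<open>a \<le> b\<close> touch modulus])
      fix k
      have "c * \<phi> k \<le> c * (\<phi> (Suc n) + (\<phi> (Suc (Suc n)) - \<phi> (Suc n)) * (real k - real (Suc n)))"
        using concave_seq_tangent[of \<phi> k "Suc n", OF concave] c0 by (intro mult_left_mono) auto
      then show "c * \<phi> k \<le> c * \<phi> (gdist q x y) + a * (real k - real (gdist q x y))"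
        unfolding a_def d by (simp add: algebra_simps)
      \<comment> \<open>The line through the values at \<open>n\<close> and \<open>Suc n\<close> is
        based at \<open>n\<close> here, then rewritten with base \<open>Suc n\<close>.\<close>
      have "c * \<phi> k \<le> c * (\<phi> n + (\<phi> (Suc n) - \<phi> n) * (real k - real n))"
        using concave_seq_tangent[of \<phi> k n, OF concave] c0 by (intro mult_left_mono) auto
      then show "c * \<phi> k \<le> c * \<phi> (gdist q x y) + b * (real k - real (gdist q x y))"
        unfolding b_def d by (simp add: algebra_simps)
    qed
    moreover have "b - a = s * (f x - f y)"
    proof -
      have "b - a = c * (2 * \<phi> (Suc n) - (\<phi> (Suc (Suc n)) + \<phi> n))"
        unfolding a_def b_def by (simp add: algebra_simps)
      then show ?thesis unfolding touch d rec[OF dN] by (simp add: algebra_simps)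
    qed
    moreover have "laplacian q f x - laplacian q f y = - (lam * (f x - f y))"
      using eigen by (simp add: algebra_simps)
    ultimately have "q_min q * s * (f x - f y) \<le> lam * (f x - f y)" by simp
    moreover have "f x - f y > 0" unfolding touch using c0 pos[of "Suc n"] d by simp
    ultimately show False using s(3) by simp
  qed
  have grad_le: "grad q f x y \<le> 2 * M * sqrt s" if "x \<noteq> y" for x y
  proof -
    define d where "d = gdist q x y"
    have "d > 0" unfolding d_def using gdist_pos[OF q(3) that] .
    have "f x - f y \<le> 2 * M * \<phi> d"
      using ratio_le[of "(x, y)"] that pos[OF \<open>d > 0\<close>] unfolding P_def r_def d_def
      by (simp add: field_simps)
    \<comment> \<open>The tangent at 0 has slope
      \<open>\<phi> 1 - \<phi> 0 = sqrt s\<close>.\<close>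
    also have "\<dots> \<le> 2 * M * (sqrt s * real d)"
      using concave_seq_tangent[of \<phi> d 0, OF concave] \<phi>0 \<phi>1 M0 by (intro mult_left_mono) auto
    finally show ?thesis
      unfolding grad_def d_def[symmetric] using \<open>d > 0\<close> by (simp add: divide_le_eq algebra_simps)
  qed
  have "grad q f x y = - grad q f y x" for x y
    unfolding grad_def gdist_sym[OF q(2,3), of x y] by (simp add: minus_divide_left)
  then have "\<bar>grad q f x y\<bar> \<le> 2 * M * sqrt s" if "x \<noteq> y" for x y
    using grad_le[of x y] grad_le[of y x] that by (metis abs_le_iff minus_minus)
  then show ?thesis using grad_norm_le[of "2 * M * sqrt s" q f] M0 s(1) unfolding M_def by simp
qed

lemma grad_norm_le_two_sup_norm:
  assumes "connected_graph q"
  shows "grad_norm q f \<le> 2 * sup_norm f"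
proof (rule grad_norm_le)
  show "0 \<le> 2 * sup_norm f" using abs_le_sup_norm[of f undefined] by linarith
  fix x y :: 'a
  assume "x \<noteq> y"
  have "\<bar>grad q f x y\<bar> = \<bar>f x - f y\<bar> / real (gdist q x y)" unfolding grad_def by simp
  also have "\<dots> \<le> \<bar>f x - f y\<bar> / 1"
    using gdist_pos[OF assms \<open>x \<noteq> y\<close>] by (intro divide_left_mono) auto
  also have "\<dots> \<le> 2 * sup_norm f" using abs_le_sup_norm[of f x] abs_le_sup_norm[of f y] by simp
  finally show "\<bar>grad q f x y\<bar> \<le> 2 * sup_norm f" .
qed

theorem mainTheorem16:
  fixes q :: "'a::finite \<Rightarrow> 'a \<Rightarrow> real" and f :: "'a \<Rightarrow> real" and lam :: real
  assumes "nonneg_weights q"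
    and "reversible q"
    and "connected_graph q"
    and "nonneg_ollivier q"
    and "\<And>x. laplacian q f x = - lam * f x"
    and "lam \<noteq> 0"
  shows "(grad_norm q f)\<^sup>2 \<le> 2 * exp 1 * lam / q_min q * (sup_norm f)\<^sup>2"
proof (cases "\<exists>x. f x \<noteq> 0")
  case False
  \<comment> \<open>Both sides vanish, whatever the value of \<open>q_min q\<close>, which on a
    graph without edges is a minimum over the empty set.\<close>
  then have "sup_norm f = 0" using sup_norm_attained[of f] by auto
  then show ?thesis
    using grad_norm_le_two_sup_norm[OF assms(3), of f] grad_norm_nonneg[of q f] by simp
next
  case True
  then obtain x where "f x \<noteq> 0" by blast
  have lam: "lam > 0" using eigenvalue_nonneg[OF assms(1,5) \<open>f x \<noteq> 0\<close>] assms(6) by simp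
  \<comment> \<open>A nonzero Laplacian forces an edge at \<open>x\<close>, so
    \<open>q_min q\<close> is a genuine minimum.\<close>
  have "laplacian q f x \<noteq> 0" using assms(5)[of x] assms(6) \<open>f x \<noteq> 0\<close> by simp
  then obtain y where "q x y * (f y - f x) \<noteq> 0"
    unfolding laplacian_def by (auto elim: sum.not_neutral_contains_not_neutral)
  then have "q x y \<noteq> 0" by simp
  then have "adj q x y" using assms(1) unfolding adj_def nonneg_weights_def by (metis less_eq_real_def)
  then have qm: "q_min q > 0" by (rule q_min_pos)
  have e2: "exp 1 > (2 :: real)"
    using exp_lower_Taylor_quadratic[of "1 :: real"] by simp
  \<comment> \<open>Chosen so that \<open>4 * s\<close> is the constant in the claim;
    \<open>lam < q_min q * s\<close> then amounts to \<open>exp 1 > 2\<close>.\<close>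
  define s where "s = exp 1 * lam / (2 * q_min q)"
  have s: "0 < s" "lam < q_min q * s" unfolding s_def using lam qm e2 by (auto simp: field_simps)
  have "(grad_norm q f)\<^sup>2 \<le> 4 * s * (sup_norm f)\<^sup>2"
  proof (cases "s < 4")
    case True
    have "(grad_norm q f)\<^sup>2 \<le> (2 * sup_norm f * sqrt s)\<^sup>2"
      by (intro power_mono grad_norm_nonneg eigenfunction_grad_norm_le[OF assms(1-5) s(1) True s(2)])
    then show ?thesis using s(1) by (simp add: power_mult_distrib mult_ac)
  next
    case False
    have "(grad_norm q f)\<^sup>2 \<le> (2 * sup_norm f)\<^sup>2"
      by (intro power_mono grad_norm_nonneg grad_norm_le_two_sup_norm[OF assms(3)])
    also have "\<dots> \<le> 4 * s * (sup_norm f)\<^sup>2"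
      using False by (simp add: power_mult_distrib mult_right_mono)
    finally show ?thesis .
  qed
  also have "4 * s = 2 * exp 1 * lam / q_min q" unfolding s_def by simp
  finally show ?thesis .
qed

end
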